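(* Let $p>1$ and $\alpha>1-1/p$, and let \[ \beta(\alpha)=\frac{\alpha}{1+p(\alpha-1)}. \] Then \[ Q(\alpha,p)^{1/(p-1)}=Q\Bigl(\beta(\alpha),\frac{p}{p-1}\Bigr). \]
   Context: For real $q>1$ and $a>1-1/q$, $Q(a,q)$ is defined by \[ Q(a,q)=\frac{a^q}{1+q(a-1)}. \] *)

theory Defs
  imports Complex_Main
begin

text \<open>
  \<open>Q a q\<close> is only meaningful for \<open>q > 1\<close> and \<open>a > 1 - 1/q\<close>; outside this range the
  function is total by HOL convention. Inside it, \<open>a > 0\<close> and the denominator is positive
  (see \<open>Q_domain\<close>), so \<open>powr\<close> is the usual real power and the quotient is genuine.
\<close>

definition Q :: "real \<Rightarrow> real \<Rightarrow> real" where
  "Q a q = a powr q / (1 + q * (a - 1))"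

definition beta :: "real \<Rightarrow> real \<Rightarrow> real" where
  "beta p \<alpha> = \<alpha> / (1 + p * (\<alpha> - 1))"

lemma Q_domain:
  fixes a q :: real
  assumes "q > 1" and "a > 1 - 1 / q"
  shows "a > 0" and "1 + q * (a - 1) > 0" and "Q a q > 0"
proof -
  have "1 / q < 1" using assms(1) by simp
  then show a: "a > 0" using assms(2) by linarith
  have "q * (1 - 1 / q) < q * a"
    using assms by (intro mult_strict_left_mono) auto
  then show d: "1 + q * (a - 1) > 0"
    using assms(1) by (simp add: algebra_simps)
  show "Q a q > 0" using a d by (simp add: Q_def)
qed

text \<open>The pair \<open>(beta p \<alpha>, p / (p - 1))\<close> again lies in the domain of \<open>Q\<close>.\<close>

lemma beta_domain:
  fixes p \<alpha> :: real
  assumes "p > 1" and "\<alpha> > 1 - 1 / p"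
  shows "p / (p - 1) > 1" and "beta p \<alpha> > 1 - 1 / (p / (p - 1))"
proof -
  show "p / (p - 1) > 1" using assms(1) by simp
  have d: "1 + p * (\<alpha> - 1) > 0" using Q_domain(2)[OF assms] .
  have "1 - 1 / (p / (p - 1)) = 1 / p"
    using assms(1) by (simp add: field_simps)
  also have "\<dots> < beta p \<alpha>"
    unfolding beta_def using assms(1) d by (simp add: divide_less_eq less_divide_eq algebra_simps)
  finally show "beta p \<alpha> > 1 - 1 / (p / (p - 1))" .
qed

end

theory Submission
  imports Defs
begin

text \<open>With \<open>D\<close> the denominator of \<open>Q \<alpha> p\<close> and
  \<open>r\<close> the exponent conjugate to \<open>p\<close>, \<open>beta p \<alpha>\<close> is
  \<open>\<alpha> / D\<close>. Passing to the conjugate pair inverts the denominator: that of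
  \<open>Q (\<alpha> / D) r\<close> is \<open>1 / D\<close>. Since \<open>p * (r - 1) = r\<close>,
  both sides equal \<open>\<alpha> powr r / D powr (r - 1)\<close>.\<close>

theorem lemma4p4:
  fixes p \<alpha> :: real
  assumes "p > 1" and "\<alpha> > 1 - 1 / p"
  shows "Q \<alpha> p powr (1 / (p - 1)) = Q (beta p \<alpha>) (p / (p - 1))"
proof -
  define D where "D = 1 + p * (\<alpha> - 1)"
  define r where "r = p / (p - 1)"
  have a: "\<alpha> > 0" and D: "D > 0"
    using Q_domain(1,2)[OF assms] by (simp_all add: D_def)
  have r: "1 / (p - 1) = r - 1" "p * (r - 1) = r"
    using assms(1) by (simp_all add: r_def field_simps)
  \<comment> \<open>Here \<open>\<alpha> - D = (p - 1) * (1 - \<alpha>)\<close> and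
    \<open>r * (p - 1) = p\<close>; the right side is \<open>1 - D\<close>, so
    \<open>D + r * (\<alpha> - D) = 1\<close>.\<close>
  have "r * (\<alpha> - D) = p * (1 - \<alpha>)"
    using r(2) by (simp add: D_def algebra_simps)
  then have "D * (1 + r * (\<alpha> / D - 1)) = 1"
    using D by (simp add: D_def field_simps)
  then have den: "1 + r * (\<alpha> / D - 1) = 1 / D"
    using D by (simp add: eq_divide_eq mult.commute)
  have "Q \<alpha> p powr (r - 1) = \<alpha> powr r / D powr (r - 1)"
    using a D r(2) by (simp add: Q_def D_def[symmetric] powr_divide powr_powr)
  \<comment> \<open>One factor \<open>D\<close> is split off \<open>D powr r\<close> to expose the
    new denominator \<open>1 / D\<close>.\<close>
  also have "\<dots> = (\<alpha> / D) powr r / (1 / D)"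
    using a D by (simp add: powr_divide powr_diff)
  also have "\<dots> = Q (beta p \<alpha>) r"
    by (simp only: Q_def beta_def D_def[symmetric] den)
  finally show ?thesis
    by (simp only: r(1) r_def[symmetric])
qed

end
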